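(* Let $r,s$ be integers with $1\le r\le s$, and let $m,n$ be integers with $2s\le m\le n<2(r+s)$. Then the graph of an $\{r,s\}$-leaper on an $m\times n$ board has no Hamiltonian circuit.
   Context: For positive integers $r,s$, the graph of an $\{r,s\}$-leaper on an $m\times n$ board has vertex set $\{(x,y): 0\le x<m,\ 0\le y<n\}$ (integers), with an edge between $(x,y)$ and $(x',y')$ whenever $(x'-x,y'-y)\in\{(\pm r,\pm s),(\pm s,\pm r)\}$. The paper's convention is $1\le r\le s$. A Hamiltonian circuit is a cycle passing through every vertex exactly once. *)

theory Defs
  imports Main "Graph_Theory.Pair_Digraph"
begin

text \<open>
  As usual in the library, an undirected graph is a symmetric digraph: the edge joining
  \<open>u\<close> and \<open>v\<close> is the pair of arcs \<open>(u, v)\<close>, \<open>(v, u)\<close>.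
\<close>

definition leaper_graph :: "int \<Rightarrow> int \<Rightarrow> int \<Rightarrow> int \<Rightarrow> (int \<times> int) pair_pre_digraph" where
  "leaper_graph r s m n =
    \<lparr> pverts = {(x, y). 0 \<le> x \<and> x < m \<and> 0 \<le> y \<and> y < n},
      parcs = {((x, y), (x', y')).
        (0 \<le> x \<and> x < m \<and> 0 \<le> y \<and> y < n) \<and> (0 \<le> x' \<and> x' < m \<and> 0 \<le> y' \<and> y' < n) \<and>
        (x' - x, y' - y) \<in> {r, - r} \<times> {s, - s} \<union> {s, - s} \<times> {r, - r}} \<rparr>"

text \<open>
  The library's \<^const>\<open>pre_digraph.cycle\<close> forbids repeated vertices, but in a symmetric digraph
  it admits the back-and-forth walk \<open>u, v, u\<close>, which is not a cycle of the undirected graph;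
  hence the bound on the length. The vertices of a cycle are the tails of its arcs.
\<close>

definition (in pre_digraph) hamiltonian_circuit :: "'b awalk \<Rightarrow> bool" where
  "hamiltonian_circuit p \<longleftrightarrow> cycle p \<and> 3 \<le> length p \<and> tail G ` set p = verts G"

lemma finite_pverts_leaper_graph: "finite (pverts (leaper_graph r s m n))"
proof (rule finite_subset)
  show "pverts (leaper_graph r s m n) \<subseteq> {0..m} \<times> {0..n}"
    by (auto simp: leaper_graph_def)
qed simp

lemma pair_graph_leaper_graph:
  assumes "1 \<le> r" and "1 \<le> s"
  shows "pair_graph (leaper_graph r s m n)"
proof
  let ?G = "leaper_graph r s m n"
  have sub: "parcs ?G \<subseteq> pverts ?G \<times> pverts ?G"
    unfolding leaper_graph_def by force
  then show "fst e \<in> pverts ?G" "snd e \<in> pverts ?G" if "e \<in> parcs ?G" for e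
    using that by (auto dest!: subsetD)
  show "finite (pverts ?G)"
    by (rule finite_pverts_leaper_graph)
  with sub show "finite (parcs ?G)"
    by (meson finite_SigmaI finite_subset)
  show "fst e \<noteq> snd e" if "e \<in> parcs ?G" for e
  proof -
    have "(0, 0) \<notin> {r, - r} \<times> {s, - s} \<union> {s, - s} \<times> {r, - r}"
      using assms by simp
    then show ?thesis
      using that by (cases e) (auto simp only: leaper_graph_def fst_conv snd_conv
        pair_pre_digraph.simps mem_Collect_eq prod.case diff_self split: prod.splits)
  qed
  have neg: "(- a, - b) \<in> {r, - r} \<times> {s, - s} \<union> {s, - s} \<times> {r, - r}"
    if "(a, b) \<in> {r, - r} \<times> {s, - s} \<union> {s, - s} \<times> {r, - r}" for a b
    using that by (elim UnE SigmaE insertE emptyE) simp_all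
  have "sym (parcs ?G)"
  proof (rule symI)
    fix u v
    assume "(u, v) \<in> parcs ?G"
    then show "(v, u) \<in> parcs ?G"
      using neg[of "fst v - fst u" "snd v - snd u"]
      by (cases u; cases v) (simp only: leaper_graph_def pair_pre_digraph.simps
        mem_Collect_eq prod.case fst_conv snd_conv minus_diff_eq simp_thms)
  qed
  moreover have "arcs_ends (with_proj ?G) = parcs ?G"
    by (simp add: arcs_ends_def arc_to_ends_def with_proj_def)
  ultimately show "symmetric (with_proj ?G)"
    by (simp add: symmetric_def)
qed

end

theory Submission
  imports Defs
begin

text \<open>
  If \<open>r\<close> and \<open>s\<close> have a common factor, or if \<open>r + s\<close> is even, the graph is disconnected.
  Otherwise there are two cases.

  If \<open>m > 2s\<close>, every cell of the four \<open>r \<times> r\<close> corner squares has degree \<open>2\<close>, so a Hamiltonian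
  circuit uses both of its edges. Since \<open>2s < m, n < 2(r + s)\<close>, there are four such cells of the form
  \<open>(x, y)\<close>, \<open>(x + 2s, y)\<close>, \<open>(x + 2s, y + 2s)\<close>, \<open>(x, y + 2s)\<close>, and any two consecutive ones have a
  common neighbour; so the circuit contains, hence is, a cycle of length \<open>8\<close>.

  If \<open>m = 2s\<close>, write every \<open>x\<close> as \<open>x = r k + s t\<close> with \<open>0 \<le> k < s\<close>. The columns with \<open>k + t\<close> even
  form an independent set that covers exactly half of the board. A circuit therefore alternates
  between this half and its complement. As it also alternates between the two colours of the
  chessboard, it misses half of the cells.
\<close>

section \<open>The cyclic successor on a Hamiltonian circuit\<close>

lemma cas_with_proj:
  "pre_digraph.cas (with_proj G) u p v \<Longrightarrow> u # map snd p = map fst p @ [v]"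
  by (induction p arbitrary: u) (auto simp: pre_digraph.cas.simps)

text \<open>\<open>\<sigma>\<close> raises the index by one modulo the length. Length at least 3
  rules out 2-cycles, and the last property expresses that \<open>\<sigma>\<close> is a single
  cycle: iterating it from any entry reaches all the others.\<close>

lemma cyclic_successor:
  assumes "distinct q" and "3 \<le> length q"
  obtains \<sigma> where "bij_betw \<sigma> (set q) (set q)"
    and "\<And>v. v \<in> set q \<Longrightarrow> (v, \<sigma> v) \<in> set (zip q (rotate1 q))"
    and "\<And>v. v \<in> set q \<Longrightarrow> \<sigma> (\<sigma> v) \<noteq> v"
    and "\<And>S. S \<subseteq> set q \<Longrightarrow> S \<noteq> {} \<Longrightarrow> \<sigma> ` S \<subseteq> S \<Longrightarrow> S = set q"
proof -
  define k where "k = length q"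
  have k: "3 \<le> k" using assms(2) by (simp add: k_def)
  define \<sigma> where "\<sigma> v = q ! (Suc (THE i. i < k \<and> q ! i = v) mod k)" for v
  have step: "\<sigma> (q ! i) = q ! (Suc i mod k)" if "i < k" for i
  proof -
    have "(THE j. j < k \<and> q ! j = q ! i) = i"
      using that assms(1) by (intro the_equality) (auto simp: k_def nth_eq_iff_index_eq)
    then show ?thesis by (simp add: \<sigma>_def)
  qed
  have index: "\<exists>i<k. v = q ! i" if "v \<in> set q" for v
    using that by (auto simp: in_set_conv_nth k_def)
  have mem: "q ! (i mod k) \<in> set q" for i
    using k by (auto simp: k_def intro!: nth_mem mod_less_divisor)
  have iter: "\<sigma> (q ! (i mod k)) = q ! (Suc i mod k)" for i
    using step[of "i mod k"] k by (simp add: mod_Suc_eq)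
  show ?thesis
  proof
    have "set q \<subseteq> \<sigma> ` set q"
    proof
      fix v assume "v \<in> set q"
      then obtain i where i: "i < k" "v = q ! i" using index by blast
      \<comment> \<open>Adding \<open>k - 1\<close> steps back by one cyclically, also for
        \<open>i = 0\<close>.\<close>
      have "\<sigma> (q ! ((i + (k - 1)) mod k)) = q ! ((i + k) mod k)"
        using iter[of "i + (k - 1)"] k by simp
      then have "\<sigma> (q ! ((i + (k - 1)) mod k)) = v"
        using i by simp
      then show "v \<in> \<sigma> ` set q" using mem by (metis imageI)
    qed
    moreover have "\<sigma> ` set q \<subseteq> set q"
      using index step mem by fastforce
    ultimately have "\<sigma> ` set q = set q" by blast
    then show "bij_betw \<sigma> (set q) (set q)"
      by (simp add: bij_betw_def finite_surj_inj)
    show "(v, \<sigma> v) \<in> set (zip q (rotate1 q))" if v: "v \<in> set q" for v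
    proof -
      obtain i where i: "i < k" "v = q ! i" using v index by blast
      have "zip q (rotate1 q) ! i = (v, \<sigma> v)"
        using i step by (simp add: k_def nth_rotate1)
      then show ?thesis using i by (metis k_def length_rotate1 length_zip min.idem nth_mem)
    qed
    show "\<sigma> (\<sigma> v) \<noteq> v" if v: "v \<in> set q" for v
    proof -
      obtain i where i: "i < k" "v = q ! i" using v index by blast
      have "\<sigma> (\<sigma> v) = q ! (Suc (Suc i) mod k)"
        using i step iter[of "Suc i"] by simp
      moreover have "Suc (Suc i) mod k \<noteq> i"
        using i k by (cases "Suc (Suc i) < k") (auto simp: mod_if)
      moreover have "Suc (Suc i) mod k < k" using k by simp
      ultimately show ?thesis
        using i nth_eq_iff_index_eq[OF assms(1)] by (simp add: k_def)
    qed
    show "S = set q" if S: "S \<subseteq> set q" "S \<noteq> {}" "\<sigma> ` S \<subseteq> S" for S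
    proof
      obtain i where i: "i < k" "q ! i \<in> S" using S index by (metis all_not_in_conv subsetD)
      have reach: "q ! ((i + j) mod k) \<in> S" for j
      proof (induction j)
        case 0
        then show ?case using i by simp
      next
        case (Suc j)
        then show ?case using iter[of "i + j"] S(3) by auto
      qed
      show "set q \<subseteq> S"
      proof
        fix v assume "v \<in> set q"
        then obtain j where j: "j < k" "v = q ! j" using index by blast
        \<comment> \<open>The summand \<open>k\<close> keeps the natural subtraction from truncating
          when \<open>j < i\<close>.\<close>
        have "(i + (j + k - i)) mod k = j" using i j by simp
        then show "v \<in> S" using reach[of "j + k - i"] j by simp
      qed
    qed (use S in simp)
  qed
qed

text \<open>Replaces the arc list by a permutation of the board; the later arguments use only these
  four properties of it.\<close>

lemma hamiltonian_circuit_successor: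
  assumes "pre_digraph.hamiltonian_circuit (with_proj G) p"
  obtains \<sigma> where "bij_betw \<sigma> (pverts G) (pverts G)"
    and "\<And>v. v \<in> pverts G \<Longrightarrow> (v, \<sigma> v) \<in> parcs G"
    and "\<And>v. v \<in> pverts G \<Longrightarrow> \<sigma> (\<sigma> v) \<noteq> v"
    and "\<And>S. S \<subseteq> pverts G \<Longrightarrow> S \<noteq> {} \<Longrightarrow> \<sigma> ` S \<subseteq> S \<Longrightarrow> S = pverts G"
proof -
  define q where "q = map fst p"
  have len: "3 \<le> length p" and verts: "set q = pverts G"
    and cyc: "pre_digraph.cycle (with_proj G) p"
    using assms by (auto simp: pre_digraph.hamiltonian_circuit_def q_def)
  then obtain u where walk: "pre_digraph.awalk (with_proj G) u p u"
    and dist: "distinct (tl (pre_digraph.awalk_verts (with_proj G) u p))"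
    by (auto simp: pre_digraph.cycle_def)
  have cas: "u # map snd p = q @ [u]" and arcs: "set p \<subseteq> parcs G"
    using walk cas_with_proj[of G u p u] by (auto simp: pre_digraph.awalk_def q_def)
  have av: "pre_digraph.awalk_verts (with_proj G) u' p' = u' # map snd p'"
    if "pre_digraph.cas (with_proj G) u' p' v'" for u' p' v'
    using that
    by (induction p' arbitrary: u')
      (auto simp: pre_digraph.cas.simps pre_digraph.awalk_verts.simps)
  have "distinct (map snd p)"
    using dist av[of u p u] walk by (simp add: pre_digraph.awalk_def)
  \<comment> \<open>By \<open>cas\<close>, the list \<open>q\<close> of tails starts with
    \<open>u\<close>, and moving that \<open>u\<close> to the end gives the heads. So distinctness
    of the heads passes to \<open>q\<close>.\<close>
  moreover have rot: "map snd p = rotate1 q"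
    using cas len by (cases q) (auto simp: q_def)
  ultimately have "distinct q" by simp
  have zip: "p = zip q (rotate1 q)"
    unfolding rot[symmetric] unfolding q_def by (simp add: zip_map_fst_snd)
  have "3 \<le> length q" using len by (simp add: q_def)
  from cyclic_successor[OF \<open>distinct q\<close> this] obtain \<sigma>
    where \<sigma>: "bij_betw \<sigma> (set q) (set q)"
      "\<And>v. v \<in> set q \<Longrightarrow> (v, \<sigma> v) \<in> set (zip q (rotate1 q))"
      "\<And>v. v \<in> set q \<Longrightarrow> \<sigma> (\<sigma> v) \<noteq> v"
      "\<And>S. S \<subseteq> set q \<Longrightarrow> S \<noteq> {} \<Longrightarrow> \<sigma> ` S \<subseteq> S \<Longrightarrow> S = set q"
    by blast
  have "(v, \<sigma> v) \<in> parcs G" if "v \<in> pverts G" for v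
    using \<sigma>(2) that arcs zip verts by blast
  from that[OF \<sigma>(1)[unfolded verts] this \<sigma>(3,4)[unfolded verts]] show ?thesis .
qed

section \<open>Cells of degree two near the corners\<close>

lemma forced_octagon:
  assumes \<sigma>: "bij_betw \<sigma> V V" "\<And>v. v \<in> V \<Longrightarrow> (v, \<sigma> v) \<in> E" "\<And>v. v \<in> V \<Longrightarrow> \<sigma> (\<sigma> v) \<noteq> v"
    and V: "{c1, c2, c3, c4, u1, u2, u3, u4} \<subseteq> V"
    and c1: "\<And>v. (c1, v) \<in> E \<or> (v, c1) \<in> E \<Longrightarrow> v \<in> {u4, u1}"
    and c2: "\<And>v. (c2, v) \<in> E \<or> (v, c2) \<in> E \<Longrightarrow> v \<in> {u1, u2}"
    and c3: "\<And>v. (c3, v) \<in> E \<or> (v, c3) \<in> E \<Longrightarrow> v \<in> {u2, u3}"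
    and c4: "\<And>v. (c4, v) \<in> E \<or> (v, c4) \<in> E \<Longrightarrow> v \<in> {u3, u4}"
    and distinct: "c1 \<noteq> c2" "c2 \<noteq> c3" "c3 \<noteq> c4" "c4 \<noteq> c1"
  shows "\<sigma> ` {c1, c2, c3, c4, u1, u2, u3, u4} \<subseteq> {c1, c2, c3, c4, u1, u2, u3, u4}"
proof -
  have inj: "v = w" if "\<sigma> v = \<sigma> w" "v \<in> V" "w \<in> V" for v w
    using \<sigma>(1) that by (meson bij_betw_def inj_onD)
  \<comment> \<open>The predecessor and the successor of \<open>c\<close> are distinct and both lie
    in \<open>{a, b}\<close>, so the circuit uses both edges at \<open>c\<close>.\<close>
  have forced: "\<sigma> c = u \<or> \<sigma> u = c"
    if "c \<in> V" "u \<in> {a, b}" and deg: "\<And>v. (c, v) \<in> E \<or> (v, c) \<in> E \<Longrightarrow> v \<in> {a, b}" for c u a b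
  proof -
    obtain v where v: "v \<in> V" "\<sigma> v = c"
      using \<sigma>(1) \<open>c \<in> V\<close> by (metis bij_betw_def imageE)
    have "v \<in> {a, b}" "\<sigma> c \<in> {a, b}" "v \<noteq> \<sigma> c"
      using deg[of v] deg[of "\<sigma> c"] \<sigma>(2)[of v] \<sigma>(2)[of c] \<sigma>(3)[of v] v \<open>c \<in> V\<close> by auto
    with \<open>u \<in> {a, b}\<close> v(2) show ?thesis by auto
  qed
  \<comment> \<open>The circuit joins \<open>u1\<close> to both \<open>c1\<close> and
    \<open>c2\<close>. By injectivity \<open>u1\<close> cannot be the successor of both, so one of
    them is the successor of \<open>u1\<close>.\<close>
  have "\<sigma> u1 \<in> {c1, c2}"
    using forced[of c1 u1 u4 u1, OF _ _ c1] forced[of c2 u1 u1 u2, OF _ _ c2]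
      inj[of c1 c2] V distinct by auto
  moreover have "\<sigma> u2 \<in> {c2, c3}"
    using forced[of c2 u2 u1 u2, OF _ _ c2] forced[of c3 u2 u2 u3, OF _ _ c3]
      inj[of c2 c3] V distinct by auto
  moreover have "\<sigma> u3 \<in> {c3, c4}"
    using forced[of c3 u3 u2 u3, OF _ _ c3] forced[of c4 u3 u3 u4, OF _ _ c4]
      inj[of c3 c4] V distinct by auto
  moreover have "\<sigma> u4 \<in> {c4, c1}"
    using forced[of c4 u4 u3 u4, OF _ _ c4] forced[of c1 u4 u4 u1, OF _ _ c1]
      inj[of c4 c1] V distinct by auto
  moreover have "\<sigma> c1 \<in> {u4, u1}" "\<sigma> c2 \<in> {u1, u2}" "\<sigma> c3 \<in> {u2, u3}" "\<sigma> c4 \<in> {u3, u4}"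
    using c1 c2 c3 c4 \<sigma>(2) V by auto
  ultimately show ?thesis by auto
qed

lemma mem_pverts_leaper_graph:
  "(x, y) \<in> pverts (leaper_graph r s m n) \<longleftrightarrow> 0 \<le> x \<and> x < m \<and> 0 \<le> y \<and> y < n"
  by (simp add: leaper_graph_def)

lemma mem_parcs_leaper_graph:
  "((x, y), (x', y')) \<in> parcs (leaper_graph r s m n) \<longleftrightarrow>
    (x, y) \<in> pverts (leaper_graph r s m n) \<and> (x', y') \<in> pverts (leaper_graph r s m n) \<and>
    ((x' = x + r \<or> x' = x - r) \<and> (y' = y + s \<or> y' = y - s) \<or>
     (x' = x + s \<or> x' = x - s) \<and> (y' = y + r \<or> y' = y - r))"
proof -
  have "u - v = d \<longleftrightarrow> u = v + d" "u - v = - d \<longleftrightarrow> u = v - d" for u v d :: int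
    by auto
  then show ?thesis by (auto simp only: leaper_graph_def pair_pre_digraph.simps
      mem_Collect_eq prod.case Un_iff mem_Times_iff fst_conv snd_conv insert_iff empty_iff)
qed

text \<open>The signs \<open>\<epsilon>\<close> and \<open>\<delta>\<close> point into the board:
  every step against them leaves it, so of the eight moves only two remain. Keeping the signs as
  parameters treats all four corners at once.\<close>

lemma corner_neighbours:
  assumes adj: "((x, y), v) \<in> parcs (leaper_graph r s m n) \<or>
      (v, (x, y)) \<in> parcs (leaper_graph r s m n)"
    and sign: "\<epsilon> \<in> {1, -1}" "\<delta> \<in> {1, -1}"
    and x: "x - \<epsilon> * r \<notin> {0..<m}" "x - \<epsilon> * s \<notin> {0..<m}"
    and y: "y - \<delta> * r \<notin> {0..<n}" "y - \<delta> * s \<notin> {0..<n}"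
  shows "v = (x + \<epsilon> * r, y + \<delta> * s) \<or> v = (x + \<epsilon> * s, y + \<delta> * r)"
proof -
  obtain x' y' where v: "v = (x', y')" by fastforce
  have flip: "z = z' + d \<longleftrightarrow> z' = z - d" "z = z' - d \<longleftrightarrow> z' = z + d" for z z' d :: int
    by auto
  have board: "x' \<in> {0..<m}" "y' \<in> {0..<n}"
    using adj by (auto simp only: v mem_parcs_leaper_graph mem_pverts_leaper_graph atLeastLessThan_iff)
  have move: "(x' = x + r \<or> x' = x - r) \<and> (y' = y + s \<or> y' = y - s) \<or>
      (x' = x + s \<or> x' = x - s) \<and> (y' = y + r \<or> y' = y - r)"
    using adj unfolding v mem_parcs_leaper_graph flip[of x x'] flip[of y y'] by blast
  have outward: "z' = z + e * d"
    if "e \<in> {1, -1}" "z - e * d \<notin> {0..<k}" "z' \<in> {0..<k}" "z' = z + d \<or> z' = z - d"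
    for z z' d k e :: int
    using that by (elim insertE emptyE disjE) simp_all
  have "x' = x + d \<or> x' = x - d \<Longrightarrow> x' = x + \<epsilon> * d" if "d \<in> {r, s}" for d
    using outward[OF sign(1) _ board(1)] x that by blast
  moreover have "y' = y + d \<or> y' = y - d \<Longrightarrow> y' = y + \<delta> * d" if "d \<in> {r, s}" for d
    using outward[OF sign(2) _ board(2)] y that by blast
  ultimately show ?thesis using move unfolding v by blast
qed

section \<open>A two-colouring of the columns\<close>

text \<open>The colour of column \<open>x\<close>; with \<open>x = r k + s t\<close>, the bounds on \<open>k\<close> make \<open>k\<close> and \<open>t\<close> unique.\<close>

definition even_column :: "int \<Rightarrow> int \<Rightarrow> int \<Rightarrow> bool" where
  "even_column r s x \<longleftrightarrow> (\<exists>k t. 0 \<le> k \<and> k < s \<and> x = r * k + s * t \<and> even (k + t))"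

text \<open>Bezout gives some representation; reducing the coefficient of \<open>r\<close> modulo
  \<open>s\<close> moves the quotient into \<open>t\<close>.\<close>

lemma column_representation:
  fixes r s x :: int
  assumes "coprime r s" and "0 < s"
  obtains k t where "0 \<le> k" "k < s" "x = r * k + s * t"
proof -
  obtain a b where "r * a + s * b = 1"
    using assms(1) by (metis bezout_int coprime_imp_gcd_eq_1 mult.commute)
  then have "x = r * (x * a) + s * (x * b)"
    by (metis distrib_left mult.left_commute mult.right_neutral)
  moreover have "r * (x * a) = r * (x * a mod s) + s * (r * (x * a div s))"
    by (metis distrib_left mod_mult_div_eq mult.left_commute)
  ultimately have "x = r * (x * a mod s) + s * (r * (x * a div s) + x * b)"
    by (simp add: distrib_left)
  with assms(2) show ?thesis by (intro that[of "x * a mod s"]) auto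
qed

text \<open>Two representations have \<open>k - k'\<close> divisible by \<open>s\<close> and smaller
  than \<open>s\<close> in absolute value, so they coincide and any one of them decides the
  colour.\<close>

lemma even_column_iff:
  assumes "coprime r s" and "0 \<le> k" "k < s"
  shows "even_column r s (r * k + s * t) \<longleftrightarrow> even (k + t)"
proof -
  have "k' = k \<and> t' = t" if "0 \<le> k'" "k' < s" "r * k + s * t = r * k' + s * t'" for k' t'
  proof -
    have eq: "r * (k - k') = s * (t' - t)" using that(3) by (simp add: algebra_simps)
    then have "s dvd k - k'"
      using assms(1) by (metis coprime_commute coprime_dvd_mult_right_iff dvd_triv_left)
    moreover have "\<bar>k - k'\<bar> < s" using assms that by auto
    ultimately have "k - k' = 0" by (meson abs_ge_self dual_order.trans dvd_imp_le_int not_less)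
    with eq assms show ?thesis by auto
  qed
  then show ?thesis using assms(2,3) unfolding even_column_def by metis
qed

lemma even_column_add_s:
  assumes "coprime r s" and "0 < s"
  shows "even_column r s (x + s) \<longleftrightarrow> \<not> even_column r s x"
proof -
  obtain k t where k: "0 \<le> k" "k < s" "x = r * k + s * t"
    using column_representation assms by blast
  then have "x + s = r * k + s * (t + 1)" by (simp add: algebra_simps)
  then show ?thesis
    using even_column_iff[OF assms(1) k(1,2)] k(3) by (metis add.assoc even_plus_one_iff)
qed

text \<open>Adding \<open>r\<close> raises \<open>k\<close> by one and flips the colour, unless
  \<open>k = s - 1\<close>. Then \<open>x + r\<close> is a multiple of \<open>s\<close> strictly
  between \<open>0\<close> and \<open>2 * s\<close>, so \<open>r + t = 1\<close> and
  \<open>k + t = s - r\<close> is odd.\<close>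

lemma even_column_add_r:
  assumes "coprime r s" and "odd (r + s)" and "0 < r" and "0 < s" and "0 \<le> x" and "x + r < 2 * s"
  shows "\<not> (even_column r s x \<and> even_column r s (x + r))"
proof -
  obtain k t where k: "0 \<le> k" "k < s" "x = r * k + s * t"
    using column_representation assms by blast
  show ?thesis
  proof (cases "k + 1 < s")
    case True
    have "x + r = r * (k + 1) + s * t" using k by (simp add: algebra_simps)
    then show ?thesis
      using even_column_iff[OF assms(1)] True k
      by (metis add.assoc add.commute even_plus_one_iff zle_add1_eq_le order_le_less zless_add1_eq)
  next
    case False
    then have ks: "k = s - 1" using k by simp
    then have x: "x + r = s * (r + t)" using k(3) by (simp add: ring_distribs mult.commute)
    then have "s * 0 < s * (r + t)" "s * (r + t) < s * 2" using assms by linarith+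
    then have "0 < r + t" "r + t < 2" using mult_less_cancel_left_pos[OF \<open>0 < s\<close>] by blast+
    then have "odd (k + t)" using ks assms(2) by simp presburger
    then show ?thesis using even_column_iff[OF assms(1) k(1,2)] k(3) by simp
  qed
qed

text \<open>The involution \<open>h\<close> makes \<open>P\<close> hold on exactly half of
  \<open>V\<close>. As \<open>\<sigma>\<close> injects this half into the other, it maps onto it,
  and nothing outside \<open>P\<close> can be sent outside \<open>P\<close>.\<close>

lemma successor_alternates:
  assumes fin: "finite V" and \<sigma>: "bij_betw \<sigma> V V"
    and indep: "\<And>v. v \<in> V \<Longrightarrow> P v \<Longrightarrow> \<not> P (\<sigma> v)"
    and h: "\<And>v. v \<in> V \<Longrightarrow> h v \<in> V \<and> h (h v) = v \<and> (P (h v) \<longleftrightarrow> \<not> P v)"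
    and v: "v \<in> V"
  shows "P (\<sigma> v) \<longleftrightarrow> \<not> P v"
proof -
  define A B where "A = {v \<in> V. P v}" and "B = {v \<in> V. \<not> P v}"
  have inj: "inj_on \<sigma> V" and img: "\<sigma> ` V = V" using \<sigma> by (auto simp: bij_betw_def)
  have "bij_betw h A B"
    by (rule bij_betw_byWitness[where f' = h]) (use h in \<open>auto simp: A_def B_def\<close>)
  then have "card A = card B" by (rule bij_betw_same_card)
  moreover have "card (\<sigma> ` A) = card A"
    using inj by (intro card_image) (auto simp: A_def inj_on_def)
  moreover have "\<sigma> ` A \<subseteq> B" using indep img by (auto simp: A_def B_def)
  ultimately have "\<sigma> ` A = B"
    using fin by (intro card_subset_eq) (auto simp: B_def)
  then have "\<not> P (\<sigma> v) \<Longrightarrow> P v"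
    using v img inj by (auto simp: A_def B_def inj_on_def image_iff set_eq_iff)
  with indep v show ?thesis by blast
qed

section \<open>Connectivity conditions and the two cases for the width\<close>

theorem theorem8:
  fixes r s m n :: int
  assumes "1 \<le> r" and "r \<le> s"
    and "2 * s \<le> m" and "m \<le> n" and "n < 2 * (r + s)"
  shows "\<nexists>p. pre_digraph.hamiltonian_circuit (with_proj (leaper_graph r s m n)) p"
proof
  have pos: "0 < r" "0 < s" "1 < m" "1 < n" using assms by linarith+
  let ?V = "pverts (leaper_graph r s m n)"
  let ?E = "parcs (leaper_graph r s m n)"
  assume "\<exists>p. pre_digraph.hamiltonian_circuit (with_proj (leaper_graph r s m n)) p"
  then obtain \<sigma> where \<sigma>: "bij_betw \<sigma> ?V ?V" "\<And>v. v \<in> ?V \<Longrightarrow> (v, \<sigma> v) \<in> ?E"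
      "\<And>v. v \<in> ?V \<Longrightarrow> \<sigma> (\<sigma> v) \<noteq> v"
    and conn: "\<And>S. S \<subseteq> ?V \<Longrightarrow> S \<noteq> {} \<Longrightarrow> \<sigma> ` S \<subseteq> S \<Longrightarrow> S = ?V"
    using hamiltonian_circuit_successor by blast
  have invariant: "P w"
    if "v \<in> ?V" "P v" "w \<in> ?V" and pres: "\<And>v. v \<in> ?V \<Longrightarrow> P v \<Longrightarrow> P (\<sigma> v)"
    for P and v w :: "int \<times> int"
  proof -
    have "{v \<in> ?V. P v} = ?V"
      using \<sigma>(1) \<open>v \<in> ?V\<close> \<open>P v\<close> pres by (intro conn) (blast dest: bij_betw_imp_surj_on)+
    with \<open>w \<in> ?V\<close> show ?thesis by blast
  qed
  \<comment> \<open>A common divisor \<open>d\<close> preserves the residue of the first coordinate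
    modulo \<open>d\<close> along the circuit, so \<open>d\<close> divides \<open>1\<close>.\<close>
  have "coprime r s"
  proof (rule coprimeI)
    fix d assume d: "d dvd r" "d dvd s"
    have "d dvd fst (1 :: int, 0 :: int)"
    proof (rule invariant[where P = "\<lambda>v. d dvd fst v"])
      show "(0, 0) \<in> ?V" "(1, 0) \<in> ?V" using pos by (auto simp: mem_pverts_leaper_graph)
      show "d dvd fst (\<sigma> v)" if "v \<in> ?V" "d dvd fst v" for v
        using \<sigma>(2)[OF that(1)] that(2) d
        by (cases v; cases "\<sigma> v") (auto simp: mem_parcs_leaper_graph)
    qed simp
    then show "is_unit d" by simp
  qed
  have odd: "odd (r + s)"
  proof
    assume even: "even (r + s)"
    have "even (fst (1 :: int, 0 :: int) + snd (1 :: int, 0 :: int))"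
    proof (rule invariant[where P = "\<lambda>v. even (fst v + snd v)"])
      show "(0, 0) \<in> ?V" "(1, 0) \<in> ?V" using pos by (auto simp: mem_pverts_leaper_graph)
      show "even (fst (\<sigma> v) + snd (\<sigma> v))" if "v \<in> ?V" "even (fst v + snd v)" for v
        using \<sigma>(2)[OF that(1)] that(2) even
        by (cases v; cases "\<sigma> v") (auto simp: mem_parcs_leaper_graph)
    qed simp
    then show False by simp
  qed
  then have "r < s" using assms by (cases "r = s") auto
  show False
  proof (cases "m = 2 * s")
    case True
    let ?P = "\<lambda>v :: int \<times> int. even_column r s (fst v)"
    let ?h = "\<lambda>v :: int \<times> int. if fst v < s then (fst v + s, snd v) else (fst v - s, snd v)"
    have s: "even_column r s (x + s) \<longleftrightarrow> \<not> even_column r s x"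
      "even_column r s (x - s) \<longleftrightarrow> \<not> even_column r s x" for x
      using even_column_add_s[OF \<open>coprime r s\<close>, of x] even_column_add_s[OF \<open>coprime r s\<close>, of "x - s"]
        assms by auto
    have indep: "\<not> ?P (\<sigma> v)" if "v \<in> ?V" "?P v" for v
    proof -
      have r: "\<not> (even_column r s x \<and> even_column r s (x + r))" if "0 \<le> x" "x + r < 2 * s" for x
        using even_column_add_r[OF \<open>coprime r s\<close> odd] that assms by simp
      obtain x y x' y' where v: "v = (x, y)" "\<sigma> v = (x', y')" by fastforce
      then have "0 \<le> x" "x < 2 * s" "0 \<le> x'" "x' < 2 * s"
        and step: "x' = x + r \<or> x' = x - r \<or> x' = x + s \<or> x' = x - s"
        using \<sigma>(2)[OF that(1)] True by (auto simp: mem_parcs_leaper_graph mem_pverts_leaper_graph)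
      \<comment> \<open>A move to the left by \<open>r\<close> is read as a move to the right from
        \<open>x'\<close>.\<close>
      moreover from step have "x' = x + r \<or> x = x' + r \<or> x' = x + s \<or> x' = x - s" by auto
      ultimately have "\<not> (even_column r s x \<and> even_column r s x')"
        using r[of x] r[of x'] s[of x] by metis
      then show ?thesis using that(2) v by simp
    qed
    have "?h v \<in> ?V \<and> ?h (?h v) = v \<and> (?P (?h v) \<longleftrightarrow> \<not> ?P v)" if "v \<in> ?V" for v
      using that assms True s by (cases v) (auto simp: mem_pverts_leaper_graph)
    then have alt: "?P (\<sigma> v) \<longleftrightarrow> \<not> ?P v" if "v \<in> ?V" for v
      using successor_alternates[where P = ?P and h = ?h, OF finite_pverts_leaper_graph \<sigma>(1) indep] that
      by blast
    \<comment> \<open>Both colourings flip at each step and agree at \<open>(0, 0)\<close>, hence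
      everywhere. But \<open>(0, 1)\<close> lies in an even column and has odd coordinate
      sum.\<close>
    have "?P (0, 1) \<longleftrightarrow> even (fst (0 :: int, 1 :: int) + snd (0 :: int, 1 :: int))"
    proof (rule invariant[where P = "\<lambda>v. ?P v \<longleftrightarrow> even (fst v + snd v)"])
      show "(0, 0) \<in> ?V" "(0, 1) \<in> ?V" using pos by (auto simp: mem_pverts_leaper_graph)
      show "?P (0, 0) \<longleftrightarrow> even (fst (0 :: int, 0 :: int) + snd (0 :: int, 0 :: int))"
        using even_column_iff[OF \<open>coprime r s\<close>, of 0 0] assms by simp
      show "?P (\<sigma> v) \<longleftrightarrow> even (fst (\<sigma> v) + snd (\<sigma> v))"
        if "v \<in> ?V" "?P v \<longleftrightarrow> even (fst v + snd v)" for v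
      proof -
        have "even (fst (\<sigma> v) + snd (\<sigma> v)) \<longleftrightarrow> odd (fst v + snd v)"
          using \<sigma>(2)[OF that(1)] odd
          by (cases v; cases "\<sigma> v") (auto simp: mem_parcs_leaper_graph)
        with alt that show ?thesis by blast
      qed
    qed
    then show False
      using even_column_iff[OF \<open>coprime r s\<close>, of 0 0] assms by simp
  next
    case False
    \<comment> \<open>The least nonnegative offsets for which a step of \<open>r\<close> beyond
      \<open>a + 2 * s\<close> or \<open>b + 2 * s\<close> leaves the board. The upper bounds on
      \<open>m\<close> and \<open>n\<close> keep them below \<open>r\<close>, so a step of
      \<open>r\<close> below \<open>a\<close> or \<open>b\<close> leaves it too.\<close>
    define a b where "a = max 0 (m - r - 2 * s)" and "b = max 0 (n - r - 2 * s)"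
    have a: "0 \<le> a" "a < r" "a + 2 * s < m" "m \<le> a + 2 * s + r"
      and b: "0 \<le> b" "b < r" "b + 2 * s < n" "n \<le> b + 2 * s + r"
      using assms False by (auto simp: a_def b_def)
    let ?S = "{(a, b), (a + 2 * s, b), (a + 2 * s, b + 2 * s), (a, b + 2 * s),
      (a + s, b + r), (a + 2 * s - r, b + s), (a + s, b + 2 * s - r), (a + r, b + s)}"
    have "?S \<subseteq> ?V"
      using a b \<open>r < s\<close> by (simp add: mem_pverts_leaper_graph)
    moreover have "\<sigma> ` ?S \<subseteq> ?S"
    proof (rule forced_octagon[OF \<sigma> \<open>?S \<subseteq> ?V\<close>])
      show "v \<in> {(a + r, b + s), (a + s, b + r)}"
        if "((a, b), v) \<in> ?E \<or> (v, (a, b)) \<in> ?E" for v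
        using corner_neighbours[OF that, of "1" "1"] a b \<open>r < s\<close> by auto
      show "v \<in> {(a + s, b + r), (a + 2 * s - r, b + s)}"
        if "((a + 2 * s, b), v) \<in> ?E \<or> (v, (a + 2 * s, b)) \<in> ?E" for v
        using corner_neighbours[OF that, of "-1" "1"] a b \<open>r < s\<close> by auto
      show "v \<in> {(a + 2 * s - r, b + s), (a + s, b + 2 * s - r)}"
        if "((a + 2 * s, b + 2 * s), v) \<in> ?E \<or> (v, (a + 2 * s, b + 2 * s)) \<in> ?E" for v
        using corner_neighbours[OF that, of "-1" "-1"] a b \<open>r < s\<close> by auto
      show "v \<in> {(a + s, b + 2 * s - r), (a + r, b + s)}"
        if "((a, b + 2 * s), v) \<in> ?E \<or> (v, (a, b + 2 * s)) \<in> ?E" for v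
        using corner_neighbours[OF that, of "1" "-1"] a b \<open>r < s\<close> by auto
    qed (use assms in auto)
    ultimately have "?S = ?V" by (intro conn) auto
    \<comment> \<open>A cell missed by the octagon; in column \<open>a\<close> the octagon has only
      the rows \<open>b\<close> and \<open>b + 2 * s\<close>.\<close>
    moreover have "(a, b + 1) \<in> ?V"
      using a b assms by (simp add: mem_pverts_leaper_graph)
    moreover have "(a, b + 1) \<notin> ?S"
    proof -
      have "2 * s \<noteq> 1" by presburger
      with pos \<open>r < s\<close> show ?thesis by simp
    qed
    ultimately show False by blast
  qed
qed

end
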